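(* Fix a directed acyclic graph $G=([n],E)$ with weights $w\in\mathbb{R}^E$ and weighted adjacency matrix $C$. Let $G^\star=([n],E^\star)$ be its transitive closure with Kleene star weights $w^\star$. (1) The set of weights $w'\in\mathbb{R}^{E^\star}$ such that $\mathrm{Q}(C)=\mathrm{Q}(C')$ is the pointed polyhedral cone $\mathcal{C}(G,w)=w^\star+\operatorname{cone}\{e_{j\to i} : j\to i\in G^\star\setminus G^\flat_w\}$. (2) The compactification of $\mathcal{C}(G,w)$ inside $\mathbb{T}^{E^\star}$ with respect to its recession cone is the set of all weights $w'$ on any DAG $H$ with $G^\flat_w\subseteq H\subseteq G^\star$ such that $\mathrm{Q}(C)=\mathrm{Q}(C')$. (3) The set of $w'\in\mathbb{R}^E$ such that $\mathrm{Q}(C)=\mathrm{Q}(C')$ is a face of the compactification $\overline{\mathcal{C}(G,w)}$.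
   Context: Min-plus conventions: $\mathbb{T}=\mathbb{R}\cup\{\infty\}$. Nodes are labeled so that edges go from smaller to larger labels. For any DAG $H$ on $[n]$ with weights $w'$, $C'$ denotes its weighted adjacency matrix: $c'_{ij}=w'(j\to i)$ on edges of $H$, $c'_{ii}=0$, $\infty$ otherwise. $\mathrm{Q}(C)=\{x\in\mathbb{R}^n/\mathbb{R}\mathbf{1}: x_i-x_j\le c_{ij}\ \forall i\neq j\}$. The transitive closure $G^\star$ has an edge $j\to i$ ($j\ne i$) whenever $G$ has a directed path from $j$ to $i$, and $w^\star(j\to i)$ is the minimum total weight of such a path (the entries of the min-plus Kleene star $C^\star$). The weighted transitive reduction $G^\flat_w$ consists of the edges $j\to i$ of $G$ that are the unique shortest directed path from $j$ to $i$ in $G$. $e_{j\to i}$ are standard basis vectors and $\operatorname{cone}$ denotes the nonnegative span. Weights $w'$ on a subgraph $H\subseteq G^\star$ are regarded as points of $\mathbb{T}^{E^\star}$ with coordinate $\infty$ exactly on $E^\star\setminus E(H)$; in particular $\mathbb{R}^E$ is regarded as a subset of $\mathbb{T}^{E^\star}$ this way. The compactification $\overline{\mathcal{C}(G,w)}$ is the closure of the cone in $\mathbb{T}^{E^\star}$ (with the topology of $(\mathbb{R}\cup\{\infty\})^{E^\star}$), i.e. the union of its images obtained by sending to $\infty$ the coordinates of faces of its recession cone. *)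

theory Defs
  imports "HOL-Analysis.Analysis"
begin

text \<open>
  A directed graph on the node set \<open>'n\<close> (a finite type in the role of \<open>[n]\<close>) is its set of edges;
  the pair \<open>(j, i)\<close> is the edge \<open>j \<rightarrow> i\<close>. A graph \<open>E\<close> is a DAG iff \<^term>\<open>acyclic E\<close>, and its
  transitive closure is \<^term>\<open>trancl E\<close>.
\<close>

text \<open>\<open>\<real>\<^sup>A\<close> for an edge set \<open>A\<close>, as a coordinate subspace of the space indexed by all node pairs.\<close>

definition weight_space :: "('n::finite \<times> 'n) set \<Rightarrow> (real ^ ('n \<times> 'n)) set" where
  "weight_space A = {w. \<forall>e. e \<notin> A \<longrightarrow> w $ e = 0}"

text \<open>The entry in row \<open>i\<close> and column \<open>j\<close> belongs to the edge \<open>j \<rightarrow> i\<close>.\<close>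

definition adj_matrix :: "('n::finite \<times> 'n) set \<Rightarrow> real ^ ('n \<times> 'n) \<Rightarrow> ereal ^ 'n ^ 'n" where
  "adj_matrix H w = (\<chi> i j. if (j, i) \<in> H then ereal (w $ (j, i)) else if i = j then 0 else \<infinity>)"

text \<open>The quotient \<open>\<real>\<^sup>n / \<real>\<one>\<close>, by equivalence classes.\<close>

definition torus_rel :: "((real ^ 'n::finite) \<times> (real ^ 'n)) set" where
  "torus_rel = {(x, y). \<exists>a. y = x + a *\<^sub>R (\<chi> i. 1)}"

definition Q :: "ereal ^ 'n ^ 'n \<Rightarrow> (real ^ 'n::finite) set set" where
  "Q C = {X \<in> UNIV // torus_rel. \<forall>x\<in>X. \<forall>i j. i \<noteq> j \<longrightarrow> ereal (x $ i - x $ j) \<le> C $ i $ j}"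

text \<open>Directed paths with at least one edge, as lists of nodes.\<close>

definition dipath :: "('n \<times> 'n) set \<Rightarrow> 'n \<Rightarrow> 'n \<Rightarrow> 'n list \<Rightarrow> bool" where
  "dipath E j i p \<longleftrightarrow> length p \<ge> 2 \<and> distinct p \<and> hd p = j \<and> last p = i \<and>
     successively (\<lambda>a b. (a, b) \<in> E) p"

definition path_weight :: "real ^ ('n::finite \<times> 'n) \<Rightarrow> 'n list \<Rightarrow> real" where
  "path_weight w p = (\<Sum>e\<leftarrow>zip p (tl p). w $ e)"

definition shortest_paths ::
  "('n::finite \<times> 'n) set \<Rightarrow> real ^ ('n \<times> 'n) \<Rightarrow> 'n \<Rightarrow> 'n \<Rightarrow> 'n list set" where
  "shortest_paths E w j i =
     {p. dipath E j i p \<and> (\<forall>q. dipath E j i q \<longrightarrow> path_weight w p \<le> path_weight w q)}"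

definition kleene_star_weight ::
  "('n::finite \<times> 'n) set \<Rightarrow> real ^ ('n \<times> 'n) \<Rightarrow> real ^ ('n \<times> 'n)" where
  "kleene_star_weight E w =
     (\<chi> e. if e \<in> E\<^sup>+ then Min {path_weight w p |p. dipath E (fst e) (snd e) p} else 0)"

definition weighted_reduction ::
  "('n::finite \<times> 'n) set \<Rightarrow> real ^ ('n \<times> 'n) \<Rightarrow> ('n \<times> 'n) set" where
  "weighted_reduction E w = {(j, i) \<in> E. shortest_paths E w j i = {[j, i]}}"

definition weight_cone ::
  "('n::finite \<times> 'n) set \<Rightarrow> real ^ ('n \<times> 'n) \<Rightarrow> (real ^ ('n \<times> 'n)) set" where
  "weight_cone E w = (\<lambda>v. kleene_star_weight E w + v) `
     (convex_cone hull {axis e 1 |e. e \<in> E\<^sup>+ - weighted_reduction E w})"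

definition pointed_polyhedral_cone_at :: "'a::euclidean_space \<Rightarrow> 'a set \<Rightarrow> bool" where
  "pointed_polyhedral_cone_at a P \<longleftrightarrow>
     (\<exists>K. P = (\<lambda>v. a + v) ` K \<and> convex_cone K \<and> polyhedron K \<and>
       (\<forall>v. v \<in> K \<and> - v \<in> K \<longrightarrow> v = 0))"

text \<open>
  \<open>\<T>\<^sup>A\<close> with \<open>\<T> = \<real> \<union> {\<infinity>}\<close>: extensional functions on \<open>A\<close> with values different from \<open>-\<infinity>\<close>, with
  the product topology.
\<close>

definition trop_space :: "'e set \<Rightarrow> ('e \<Rightarrow> ereal) topology" where
  "trop_space A = product_topology (\<lambda>_. top_of_set {- \<infinity><..}) A"

text \<open>
  For \<open>B \<subseteq> A\<close>, the inclusion of \<open>\<real>\<^sup>B\<close> into \<open>\<T>\<^sup>A\<close> with the coordinate \<open>\<infinity>\<close> exactly on \<open>A - B\<close>. Applied to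
  a point of a larger space, it sends the coordinates in \<open>A - B\<close> to \<open>\<infinity>\<close> and keeps those in \<open>B\<close>.
\<close>

definition trop_point :: "'e set \<Rightarrow> 'e set \<Rightarrow> real ^ ('e::finite) \<Rightarrow> 'e \<Rightarrow> ereal" where
  "trop_point A B w = (\<lambda>e\<in>A. if e \<in> B then ereal (w $ e) else \<infinity>)"

definition compactification :: "'e set \<Rightarrow> (real ^ ('e::finite)) set \<Rightarrow> ('e \<Rightarrow> ereal) set" where
  "compactification A P = (trop_space A) closure_of (trop_point A A ` P)"

definition recession_cone :: "'a::real_vector set \<Rightarrow> 'a set" where
  "recession_cone P = {v. \<forall>x\<in>P. \<forall>t\<ge>0. x + t *\<^sub>R v \<in> P}"

definition coords :: "(real ^ ('e::finite)) set \<Rightarrow> 'e set" where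
  "coords \<tau> = {e. \<exists>v\<in>\<tau>. v $ e \<noteq> 0}"

text \<open>
  The image of \<open>P\<close> obtained by sending to \<open>\<infinity>\<close> the coordinates of a face \<open>\<tau>\<close> of its recession cone;
  the face \<open>\<tau> = {0}\<close> of a pointed cone yields \<open>P\<close> itself.
\<close>

definition image_at_infinity ::
  "'e set \<Rightarrow> (real ^ ('e::finite)) set \<Rightarrow> (real ^ 'e) set \<Rightarrow> ('e \<Rightarrow> ereal) set" where
  "image_at_infinity A \<tau> P = trop_point A (A - coords \<tau>) ` P"

text \<open>
  The (nonempty) faces of the compactification are the faces of its strata, the images of \<open>P\<close> at
  infinity. The faces of the stratum of \<open>\<tau>\<close> are the images of the faces of \<open>P\<close> that are unbounded in
  all directions of \<open>\<tau>\<close>. They are polyhedra in the finite coordinates of the stratum, hence in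
  general not closed in \<open>\<T>\<^sup>A\<close>.
\<close>

definition face_of_compactification ::
  "'e set \<Rightarrow> (real ^ ('e::finite)) set \<Rightarrow> ('e \<Rightarrow> ereal) set \<Rightarrow> bool" where
  "face_of_compactification A P S \<longleftrightarrow>
     (\<exists>\<tau> F. \<tau> face_of recession_cone P \<and> \<tau> \<noteq> {} \<and> F face_of P \<and> F \<noteq> {} \<and>
        \<tau> \<subseteq> recession_cone F \<and> S = image_at_infinity A \<tau> F)"

end

theory Submission
  imports Defs
begin

text \<open>
  Everything rests on one description (\<open>Q_eq_iff_weights\<close>): for \<open>G\<^sup>\<flat> \<subseteq> H \<subseteq> G\<^sup>\<star>\<close>, weights \<open>w'\<close> on \<open>H\<close>
  define the same polyhedron as \<open>w\<close> iff \<open>w' \<ge> w\<^sup>\<star>\<close> on \<open>H\<close>, with equality on \<open>G\<^sup>\<flat>\<close>. It is necessary because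
  a Kleene star entry is the maximum of the corresponding coordinate difference over the polyhedron,
  so that \<open>w'\<close> and \<open>w\<close> have the same Kleene star on the paths of \<open>H\<close>, and because \<open>w\<^sup>\<star>\<close> satisfies
  the triangle inequality strictly on \<open>G\<^sup>\<flat>\<close>. It is sufficient because an edge of \<open>G\<^sup>\<star>\<close> outside \<open>G\<^sup>\<flat>\<close>
  satisfies it with equality for some intermediate node, so that its inequality follows from those
  of \<open>G\<^sup>\<flat>\<close>. The conditions on \<open>w'\<close> are independent for different coordinates: this makes the set of
  weights a translated coordinate cone and its compactification a product of points and closed rays,
  whose strata are given by the sets of infinite coordinates.
\<close>

section \<open>Paths and Kleene star weights\<close>

text \<open>Since \<open>E\<^sup>+\<close> is transitive, a walk is sorted with respect to it, and
  acyclicity makes it irreflexive. So walks are automatically paths, which lets paths be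
  concatenated freely.\<close>

lemma distinct_if_successively_acyclic:
  assumes "acyclic E" and "successively (\<lambda>a b. (a, b) \<in> E) p"
  shows "distinct p" and "length p \<ge> 2 \<Longrightarrow> (hd p, last p) \<in> E\<^sup>+"
proof -
  have tr: "transp (\<lambda>a b. (a, b) \<in> E\<^sup>+)"
    by (meson transpI trancl_trans)
  have "successively (\<lambda>a b. (a, b) \<in> E\<^sup>+) p"
    using assms(2) by (rule successively_mono) auto
  then have s: "sorted_wrt (\<lambda>a b. (a, b) \<in> E\<^sup>+) p"
    using successively_conv_sorted_wrt[OF tr] by simp
  have irr: "(a, a) \<notin> E\<^sup>+" for a
    using assms(1) by (simp add: acyclic_def)
  from s show "distinct p"
    by (induction p) (use irr in auto)
  show "(hd p, last p) \<in> E\<^sup>+" if "length p \<ge> 2"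
  proof (cases p)
    case (Cons a q)
    then have "q \<noteq> []" using that by auto
    then show ?thesis using s Cons by (auto dest: last_in_set)
  qed (use that in auto)
qed

lemma dipath_acyclic_iff:
  assumes "acyclic E"
  shows "dipath E j i p \<longleftrightarrow>
    length p \<ge> 2 \<and> hd p = j \<and> last p = i \<and> successively (\<lambda>a b. (a, b) \<in> E) p"
  using distinct_if_successively_acyclic(1)[OF assms] unfolding dipath_def by auto

lemma dipath_trancl:
  assumes "acyclic E" and "dipath E j i p"
  shows "(j, i) \<in> E\<^sup>+"
  using distinct_if_successively_acyclic(2)[OF assms(1)] assms(2) unfolding dipath_def by auto

lemma dipath_edge_iff:
  assumes "acyclic E"
  shows "dipath E j i [j, i] \<longleftrightarrow> (j, i) \<in> E"
  by (simp add: dipath_acyclic_iff[OF assms])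

lemma path_weight_append:
  assumes "p \<noteq> []" and "q \<noteq> []" and "last p = hd q"
  shows "path_weight w (p @ tl q) = path_weight w p + path_weight w q"
  using assms
proof (induction p rule: induct_list012)
  case (2 x)
  then show ?case by (cases q) (auto simp: path_weight_def)
next
  case (3 x y zs)
  then show ?case by (simp add: path_weight_def add.assoc)
qed simp

text \<open>Taking \<open>tl q\<close> drops the second copy of the shared node \<open>k\<close>.
  That \<open>k\<close> lies on the concatenation later tells it apart from the single edge
  \<open>[j, i]\<close>.\<close>

lemma dipath_append:
  assumes "acyclic E" and "dipath E j k p" and "dipath E k i q"
  shows "dipath E j i (p @ tl q)"
    and "path_weight w (p @ tl q) = path_weight w p + path_weight w q"
    and "k \<in> set (p @ tl q)"
proof -
  from assms obtain a p' where p: "p = a # p'" "p' \<noteq> []"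
    by (cases p) (auto simp: dipath_def Suc_le_eq)
  from assms obtain b q' where q: "q = b # q'" "q' \<noteq> []"
    by (cases q) (auto simp: dipath_def Suc_le_eq)
  show "dipath E j i (p @ tl q)"
    using assms(2,3) p q unfolding dipath_acyclic_iff[OF assms(1)]
    by (auto simp: successively_append_iff successively_Cons Suc_le_eq)
  show "path_weight w (p @ tl q) = path_weight w p + path_weight w q"
    using assms(2,3) p q by (intro path_weight_append) (auto simp: dipath_def)
  show "k \<in> set (p @ tl q)"
    using assms(2) p by (auto simp: dipath_def)
qed

lemma dipath_cases:
  assumes "acyclic E" and "dipath E j i p"
  obtains "p = [j, i]" and "(j, i) \<in> E"
  | k q where "p = j # q" and "(j, k) \<in> E" and "dipath E k i q"
      and "\<And>w. path_weight w p = w $ (j, k) + path_weight w q"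
proof -
  from assms(2) obtain k r where p: "p = j # k # r"
    by (cases p; cases "tl p") (auto simp: dipath_def)
  show ?thesis
  proof (cases "r = []")
    case True
    then show ?thesis
      using assms that(1) p by (auto simp: dipath_def)
  next
    case False
    then have "length (k # r) \<ge> 2" by (cases r) auto
    then show ?thesis
      using assms p that(2)[of "k # r" k] False
      by (auto simp: dipath_acyclic_iff[OF assms(1)] path_weight_def)
  qed
qed

lemma dipath_exists:
  fixes E :: "('n::finite \<times> 'n) set"
  assumes "acyclic E" and "(j, i) \<in> E\<^sup>+"
  shows "\<exists>p. dipath E j i p"
  using assms(2)
proof (induction rule: trancl_induct)
  case (base y)
  then show ?case using dipath_edge_iff[OF assms(1)] by blast
next
  case (step y z)
  then show ?case
    using dipath_append(1)[OF assms(1)] dipath_edge_iff[OF assms(1)] by blast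
qed

lemma finite_dipaths: "finite {p. dipath E j i (p :: 'n::finite list)}"
  by (rule finite_subset[OF _ finite_subset_distinct[of UNIV]]) (auto simp: dipath_def)

section \<open>Kleene star weights as attained minima, and their triangle inequality\<close>

lemma kleene_star_weight_le:
  assumes "acyclic E" and "dipath E j i p"
  shows "kleene_star_weight E w $ (j, i) \<le> path_weight w p"
  using dipath_trancl[OF assms] assms(2) finite_dipaths[of E j i]
  by (auto simp: kleene_star_weight_def intro!: Min_le)

lemma kleene_star_weight_attained:
  assumes "acyclic E" and "(j, i) \<in> E\<^sup>+"
  obtains p where "dipath E j i p" and "kleene_star_weight E w $ (j, i) = path_weight w p"
proof -
  let ?S = "{path_weight w p |p. dipath E j i p}"
  have "finite ?S"
    using finite_dipaths[of E j i] by simp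
  moreover have "?S \<noteq> {}"
    using dipath_exists[OF assms] by blast
  ultimately have "Min ?S \<in> ?S"
    by (rule Min_in)
  then show ?thesis
    using that assms(2) by (auto simp: kleene_star_weight_def)
qed

lemma kleene_star_weight_le_edge:
  assumes "acyclic E" and "(j, i) \<in> E"
  shows "kleene_star_weight E w $ (j, i) \<le> w $ (j, i)"
  using kleene_star_weight_le[OF assms(1), of j i "[j, i]" w] assms
  by (simp add: dipath_edge_iff path_weight_def)

lemma kleene_star_weight_triangle:
  assumes "acyclic E" and "(j, k) \<in> E\<^sup>+" and "(k, i) \<in> E\<^sup>+"
  shows "kleene_star_weight E w $ (j, i)
    \<le> kleene_star_weight E w $ (j, k) + kleene_star_weight E w $ (k, i)"
proof -
  obtain p where p: "dipath E j k p" "kleene_star_weight E w $ (j, k) = path_weight w p"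
    using kleene_star_weight_attained[OF assms(1,2)] .
  obtain q where q: "dipath E k i q" "kleene_star_weight E w $ (k, i) = path_weight w q"
    using kleene_star_weight_attained[OF assms(1,3)] .
  show ?thesis
    using kleene_star_weight_le[OF assms(1) dipath_append(1)[OF assms(1) p(1) q(1)], of w]
      dipath_append(2)[OF assms(1) p(1) q(1), of w] p q by simp
qed

section \<open>Strictness and equality in the triangle inequality\<close>

lemma weighted_reduction_subset: "weighted_reduction E w \<subseteq> E"
  by (auto simp: weighted_reduction_def)

lemma kleene_star_weight_reduction:
  assumes "acyclic E" and "(j, i) \<in> weighted_reduction E w"
  shows "kleene_star_weight E w $ (j, i) = w $ (j, i)"
proof -
  have e: "(j, i) \<in> E" and s: "shortest_paths E w j i = {[j, i]}"
    using assms(2) by (auto simp: weighted_reduction_def)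
  obtain p where "dipath E j i p" "kleene_star_weight E w $ (j, i) = path_weight w p"
    using kleene_star_weight_attained[OF assms(1) r_into_trancl[OF e]] .
  moreover from this have "path_weight w [j, i] \<le> path_weight w p"
    using s by (auto simp: shortest_paths_def)
  ultimately show ?thesis
    using kleene_star_weight_le_edge[OF assms(1) e, of w] by (simp add: path_weight_def)
qed

text \<open>Otherwise optimal paths from \<open>j\<close> to \<open>k\<close> and from
  \<open>k\<close> to \<open>i\<close> would join to a second shortest path beside the edge, which
  is the only one.\<close>

lemma reduction_triangle_strict:
  assumes "acyclic E" and "(j, i) \<in> weighted_reduction E w"
    and "(j, k) \<in> E\<^sup>+" and "(k, i) \<in> E\<^sup>+"
  shows "kleene_star_weight E w $ (j, i)
    < kleene_star_weight E w $ (j, k) + kleene_star_weight E w $ (k, i)"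
proof (rule ccontr)
  assume le: "\<not> ?thesis"
  have s: "shortest_paths E w j i = {[j, i]}"
    using assms(2) by (auto simp: weighted_reduction_def)
  obtain p where p: "dipath E j k p" "kleene_star_weight E w $ (j, k) = path_weight w p"
    using kleene_star_weight_attained[OF assms(1,3)] .
  obtain q where q: "dipath E k i q" "kleene_star_weight E w $ (k, i) = path_weight w q"
    using kleene_star_weight_attained[OF assms(1,4)] .
  have "path_weight w (p @ tl q) \<le> kleene_star_weight E w $ (j, i)"
    using le p q dipath_append(2)[OF assms(1) p(1) q(1), of w] by simp
  then have "p @ tl q \<in> shortest_paths E w j i"
    using dipath_append(1)[OF assms(1) p(1) q(1)] kleene_star_weight_le[OF assms(1), of j i _ w]
    by (fastforce simp: shortest_paths_def)
  \<comment> \<open>Either value of \<open>k\<close> closes a cycle.\<close>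
  then have "k \<in> {j, i}"
    using s dipath_append(3)[OF assms(1) p(1) q(1)] by auto
  then show False
    using assms by (auto simp: acyclic_def)
qed

text \<open>Some shortest path differs from \<open>[j, i]\<close>: the pair is no edge of
  \<open>E\<close>, or the edge is not a shortest path, or it is not the only one. The second node
  of that path serves as \<open>k\<close>.\<close>

lemma nonreduction_triangle_eq:
  assumes "acyclic E" and "(j, i) \<in> E\<^sup>+" and "(j, i) \<notin> weighted_reduction E w"
  obtains k where "(j, k) \<in> E\<^sup>+" and "(k, i) \<in> E\<^sup>+"
    and "kleene_star_weight E w $ (j, i)
      = kleene_star_weight E w $ (j, k) + kleene_star_weight E w $ (k, i)"
proof -
  obtain p where p: "dipath E j i p" "kleene_star_weight E w $ (j, i) = path_weight w p"
    using kleene_star_weight_attained[OF assms(1,2)] .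
  then have ps: "p \<in> shortest_paths E w j i"
    using kleene_star_weight_le[OF assms(1), of j i _ w] by (auto simp: shortest_paths_def)
  obtain q where q: "q \<in> shortest_paths E w j i" "q \<noteq> [j, i]"
  proof (cases "p = [j, i]")
    case True
    then have "(j, i) \<in> E"
      using p dipath_edge_iff[OF assms(1)] by blast
    then have "shortest_paths E w j i \<noteq> {[j, i]}"
      using assms(3) by (auto simp: weighted_reduction_def)
    then show ?thesis using ps that by blast
  qed (use that ps in blast)
  have qd: "dipath E j i q" and qw: "path_weight w q \<le> kleene_star_weight E w $ (j, i)"
    using q(1) p by (auto simp: shortest_paths_def)
  from assms(1) qd show ?thesis
  proof (cases rule: dipath_cases)
    case 1
    then show ?thesis using q by blast
  next
    case (2 k r)
    have jk: "(j, k) \<in> E\<^sup>+" and ki: "(k, i) \<in> E\<^sup>+"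
      using 2 dipath_trancl[OF assms(1)] by auto
    \<comment> \<open>With \<open>d\<close> for the Kleene star weights, \<open>d(j,i) <= d(j,k) +
      d(k,i) <= w(j,k) + path_weight w r = path_weight w q <= d(j,i)\<close>, so equality holds
      throughout.\<close>
    show ?thesis
      using that[OF jk ki] kleene_star_weight_triangle[OF assms(1) jk ki, of w] qw 2(4)[of w]
        kleene_star_weight_le_edge[OF assms(1) 2(2), of w]
        kleene_star_weight_le[OF assms(1) 2(3), of w] by linarith
  qed
qed

section \<open>Weighted digraph polyhedra\<close>

text \<open>The preimage of the polyhedron in the space of representatives, so that the arguments
  can avoid the quotient by the all-ones line.\<close>

definition potentials :: "('n::finite \<times> 'n) set \<Rightarrow> real ^ ('n \<times> 'n) \<Rightarrow> (real ^ 'n) set" where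
  "potentials H w = {x. \<forall>(j, i)\<in>H. x $ i - x $ j \<le> w $ (j, i)}"

lemma potentials_D: "x \<in> potentials H w \<Longrightarrow> (j, i) \<in> H \<Longrightarrow> x $ i - x $ j \<le> w $ (j, i)"
  by (auto simp: potentials_def)

lemma equiv_torus_rel: "equiv UNIV torus_rel"
proof (rule equivI)
  show "torus_rel \<subseteq> (UNIV :: (real ^ 'n) set) \<times> UNIV" by simp
  show "refl (torus_rel :: ((real ^ 'n) \<times> _) set)"
    by (auto simp: refl_on_def torus_rel_def intro: exI[of _ 0])
  show "sym (torus_rel :: ((real ^ 'n) \<times> _) set)"
  proof (rule symI)
    fix x y :: "real ^ 'n" assume "(x, y) \<in> torus_rel"
    then obtain a where "y = x + a *\<^sub>R (\<chi> i. 1)" by (auto simp: torus_rel_def)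
    then have "x = y + (- a) *\<^sub>R (\<chi> i. 1)" by simp
    then show "(y, x) \<in> torus_rel" unfolding torus_rel_def by blast
  qed
  show "trans (torus_rel :: ((real ^ 'n) \<times> _) set)"
    by (rule transI) (auto simp: torus_rel_def add.assoc simp flip: scaleR_add_left)
qed

text \<open>Acyclicity excludes loops, so the restriction to \<open>i \<noteq> j\<close> drops no
  edge of \<open>H\<close>, and the infinite entries impose nothing. Differences of coordinates are
  invariant under shifts, so one representative decides for its class.\<close>

lemma torus_class_mem_Q_iff:
  assumes "acyclic H"
  shows "torus_rel `` {x} \<in> Q (adj_matrix H w) \<longleftrightarrow> x \<in> potentials H w"
proof -
  have "(j, i) \<in> H \<Longrightarrow> i \<noteq> j" for i j
    using assms by (auto simp: acyclic_def)
  then have feas: "(\<forall>i j. i \<noteq> j \<longrightarrow> ereal (y $ i - y $ j) \<le> adj_matrix H w $ i $ j)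
      \<longleftrightarrow> y \<in> potentials H w" for y
    by (auto simp: potentials_def adj_matrix_def)
  have shift: "y \<in> potentials H w \<longleftrightarrow> x \<in> potentials H w" if "y \<in> torus_rel `` {x}" for y
    using that by (auto simp: torus_rel_def potentials_def)
  have "x \<in> torus_rel `` {x}"
    using equiv_class_self[OF equiv_torus_rel] by blast
  then have "(\<forall>y\<in>torus_rel `` {x}. y \<in> potentials H w) \<longleftrightarrow> x \<in> potentials H w"
    using shift by blast
  then show ?thesis
    unfolding Q_def feas by (simp only: mem_Collect_eq quotientI[OF UNIV_I] simp_thms)
qed

lemma Q_eq_iff:
  assumes "acyclic H" and "acyclic H'"
  shows "Q (adj_matrix H w) = Q (adj_matrix H' w') \<longleftrightarrow> potentials H w = potentials H' w'"
proof
  assume "Q (adj_matrix H w) = Q (adj_matrix H' w')"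
  then show "potentials H w = potentials H' w'"
    using torus_class_mem_Q_iff[OF assms(1)] torus_class_mem_Q_iff[OF assms(2)] by blast
next
  assume eq: "potentials H w = potentials H' w'"
  have "X \<in> Q (adj_matrix H w) \<longleftrightarrow> X \<in> Q (adj_matrix H' w')" if "X \<in> UNIV // torus_rel" for X
    using that
  proof (rule quotientE)
    fix x assume "X = torus_rel `` {x}"
    then show ?thesis
      using torus_class_mem_Q_iff[OF assms(1)] torus_class_mem_Q_iff[OF assms(2)] eq by blast
  qed
  moreover have "Q C \<subseteq> UNIV // torus_rel" for C :: "ereal ^ 'a ^ 'a"
    by (auto simp: Q_def)
  ultimately show "Q (adj_matrix H w) = Q (adj_matrix H' w')"
    by blast
qed

section \<open>Kleene star weights as maxima of coordinate differences\<close>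

lemma potentials_dipath:
  assumes "acyclic E" and "x \<in> potentials E w" and "dipath E j i p"
  shows "x $ i - x $ j \<le> path_weight w p"
  using assms(3)
proof (induction p arbitrary: j)
  case Nil
  then show ?case by (simp add: dipath_def)
next
  case (Cons a p)
  from assms(1) Cons.prems show ?case
  proof (cases rule: dipath_cases)
    case 1
    then show ?thesis using potentials_D[OF assms(2)] by (simp add: path_weight_def)
  next
    case (2 k q)
    then show ?thesis using Cons.IH[of k] potentials_D[OF assms(2), of j k] 2(4)[of w] by simp
  qed
qed

lemma potentials_kleene:
  assumes "acyclic E" and "x \<in> potentials E w" and "(j, i) \<in> E\<^sup>+"
  shows "x $ i - x $ j \<le> kleene_star_weight E w $ (j, i)"
  using kleene_star_weight_attained[OF assms(1,3), of w] potentials_dipath[OF assms(1,2)] by metis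

text \<open>The shortest path distances from \<open>j\<close> give the point; on the nodes that \<open>j\<close> does not reach it
  takes large values that decrease quickly along the edges.\<close>

lemma potentials_tight:
  assumes "acyclic E" and "(j, i) \<in> E\<^sup>+"
  obtains x where "x \<in> potentials E w" and "x $ i - x $ j = kleene_star_weight E w $ (j, i)"
proof -
  define d where "d = kleene_star_weight E w"
  \<comment> \<open>\<open>M\<close> dominates the sum of any one \<open>\<bar>d $ e\<bar>\<close>
    and any one \<open>\<bar>w $ e'\<bar>\<close>; \<open>h\<close> counts the nodes reachable from
    \<open>a\<close>, including \<open>a\<close>, so it is at least 1 and drops by at least 1 along
    every edge.\<close>
  define M where "M = (\<Sum>e\<in>UNIV. \<bar>d $ e\<bar>) + (\<Sum>e\<in>UNIV. \<bar>w $ e\<bar>)"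
  define h where "h a = real (card (E\<^sup>* `` {a}))" for a
  define x where "x = (\<chi> k. if k = j then 0 else if (j, k) \<in> E\<^sup>+ then d $ (j, k) else M * h k)"
  have irr: "(a, a) \<notin> E\<^sup>+" for a
    using assms(1) by (simp add: acyclic_def)
  have abs_le: "\<bar>u $ e\<bar> \<le> (\<Sum>e\<in>UNIV. \<bar>u $ e\<bar>)" for u :: "real ^ ('a \<times> 'a)" and e
    by (rule member_le_sum) auto
  have M: "\<bar>d $ e\<bar> + \<bar>w $ e'\<bar> \<le> M" for e e'
    unfolding M_def by (intro add_mono abs_le)
  then have M0: "M \<ge> 0" using abs_ge_zero add_nonneg_nonneg order_trans by meson
  have h1: "h a \<ge> 1" for a
  proof -
    have "card {a} \<le> card (E\<^sup>* `` {a})" by (intro card_mono) auto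
    then show ?thesis by (simp add: h_def)
  qed
  have Mh: "M \<le> M * h a" for a
    using mult_left_mono[OF h1 M0, of a] by simp
  have hstep: "h b + 1 \<le> h a" if "(a, b) \<in> E" for a b
  proof -
    have "a \<notin> E\<^sup>* `` {b}"
      using that irr[of a] by (auto dest: rtrancl_into_trancl2)
    moreover have "E\<^sup>* `` {b} \<subseteq> E\<^sup>* `` {a}"
      using that by auto
    ultimately have "E\<^sup>* `` {b} \<subset> E\<^sup>* `` {a}"
      by auto
    then have "card (E\<^sup>* `` {b}) < card (E\<^sup>* `` {a})"
      by (intro psubset_card_mono) auto
    then show ?thesis by (simp add: h_def)
  qed
  have "x $ b - x $ a \<le> w $ (a, b)" if e: "(a, b) \<in> E" for a b
  proof -
    have dw: "d $ (a, b) \<le> w $ (a, b)"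
      using kleene_star_weight_le_edge[OF assms(1) e] by (simp add: d_def)
    consider "a = j" | "a \<noteq> j" "(j, a) \<in> E\<^sup>+" | "a \<noteq> j" "(j, a) \<notin> E\<^sup>+"
      by blast
    then show ?thesis
    proof cases
      case 1
      then show ?thesis using e dw irr by (auto simp: x_def)
    next
      case 2
      then have "(j, b) \<in> E\<^sup>+" using e by auto
      moreover have "d $ (j, b) \<le> d $ (j, a) + d $ (a, b)"
        using kleene_star_weight_triangle[OF assms(1) 2(2) r_into_trancl[OF e]] by (simp add: d_def)
      ultimately show ?thesis using 2 dw irr by (auto simp: x_def)
    next
      case 3
      \<comment> \<open>If \<open>j\<close> does not reach \<open>b\<close> and
        \<open>b \<noteq> j\<close>, the value drops by at least \<open>M\<close> along the edge.
        Otherwise \<open>x $ b\<close> is \<open>d $ (j, b)\<close> or 0, while \<open>x $ a\<close>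
        is at least \<open>M\<close>.\<close>
      have "M * (h b + 1) \<le> M * h a"
        using mult_left_mono[OF hstep[OF e] M0] .
      then show ?thesis
        using 3 M[of "(j, b)" "(a, b)"] Mh[of a] by (auto simp: x_def algebra_simps)
    qed
  qed
  then have "x \<in> potentials E w"
    by (auto simp: potentials_def)
  moreover have "x $ i - x $ j = d $ (j, i)"
    using assms(2) irr by (auto simp: x_def)
  ultimately show ?thesis
    using that by (simp add: d_def)
qed

text \<open>All Kleene star inequalities follow from those on the reduction, by induction on the
  number of nodes strictly between \<open>j\<close> and \<open>i\<close>: off the reduction an entry
  is the sum of two entries with fewer nodes between their ends. The inequalities of
  \<open>E\<close> are weaker still.\<close>

lemma potentials_reduction:
  assumes "acyclic E" and "weighted_reduction E w \<subseteq> H"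
    and "\<And>e. e \<in> weighted_reduction E w \<Longrightarrow> w' $ e = kleene_star_weight E w $ e"
  shows "potentials H w' \<subseteq> potentials E w"
proof
  fix x assume x: "x \<in> potentials H w'"
  have "x $ i - x $ j \<le> kleene_star_weight E w $ (j, i)" if "(j, i) \<in> E\<^sup>+" for i j
    using that
  proof (induction "card {k. (j, k) \<in> E\<^sup>+ \<and> (k, i) \<in> E\<^sup>+}" arbitrary: i j rule: less_induct)
    case less
    show ?case
    proof (cases "(j, i) \<in> weighted_reduction E w")
      case True
      then show ?thesis using potentials_D[OF x, of j i] assms by auto
    next
      case False
      obtain k where k: "(j, k) \<in> E\<^sup>+" "(k, i) \<in> E\<^sup>+"
        and eq: "kleene_star_weight E w $ (j, i)
          = kleene_star_weight E w $ (j, k) + kleene_star_weight E w $ (k, i)"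
        using nonreduction_triangle_eq[OF assms(1) less.prems False] .
      have irr: "(k, k) \<notin> E\<^sup>+"
        using assms(1) by (simp add: acyclic_def)
      let ?I = "\<lambda>j i. {l. (j, l) \<in> E\<^sup>+ \<and> (l, i) \<in> E\<^sup>+}"
      \<comment> \<open>The node \<open>k\<close> lies between \<open>j\<close> and \<open>i\<close>
        but in neither of the smaller sets.\<close>
      have "?I j k \<subset> ?I j i" "?I k i \<subset> ?I j i"
        using k irr by (auto intro: trancl_trans)
      then have "card (?I j k) < card (?I j i)" "card (?I k i) < card (?I j i)"
        by (auto intro!: psubset_card_mono)
      then show ?thesis
        using less.hyps[of j k] less.hyps[of k i] k eq by linarith
    qed
  qed
  then show "x \<in> potentials E w"
    using kleene_star_weight_le_edge[OF assms(1), of _ _ w]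
    by (fastforce simp: potentials_def)
qed

theorem Q_eq_iff_weights:
  assumes "acyclic E" and "weighted_reduction E w \<subseteq> H" and "H \<subseteq> E\<^sup>+"
  shows "Q (adj_matrix E w) = Q (adj_matrix H w') \<longleftrightarrow>
    (\<forall>e\<in>H. kleene_star_weight E w $ e \<le> w' $ e) \<and>
    (\<forall>e\<in>weighted_reduction E w. w' $ e = kleene_star_weight E w $ e)"
    (is "?Q \<longleftrightarrow> ?ge \<and> ?eq")
proof -
  have H: "acyclic H"
    using acyclic_subset[of "E\<^sup>+" H] assms by (simp add: acyclic_def)
  have HT: "H\<^sup>+ \<subseteq> E\<^sup>+"
    using trancl_mono_subset[OF assms(3)] by simp
  show ?thesis unfolding Q_eq_iff[OF assms(1) H]
  proof safe
    assume P: "potentials E w = potentials H w'"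
    have kleene_eq: "kleene_star_weight H w' $ (j, i) = kleene_star_weight E w $ (j, i)"
      if "(j, i) \<in> H\<^sup>+" for i j
    proof (rule antisym)
      have "(j, i) \<in> E\<^sup>+" using that HT by auto
      with that show "kleene_star_weight H w' $ (j, i) \<le> kleene_star_weight E w $ (j, i)"
        using potentials_tight[OF H that, of w'] potentials_kleene[OF assms(1), of _ w] P by metis
      from \<open>(j, i) \<in> E\<^sup>+\<close> that
      show "kleene_star_weight E w $ (j, i) \<le> kleene_star_weight H w' $ (j, i)"
        using potentials_tight[OF assms(1), of j i w] potentials_kleene[OF H, of _ w'] P by metis
    qed
    show "kleene_star_weight E w $ (j, i) \<le> w' $ (j, i)" if "(j, i) \<in> H" for j i
      using kleene_eq[OF r_into_trancl[OF that]] kleene_star_weight_le_edge[OF H that, of w']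
      by linarith
    show "w' $ (j, i) = kleene_star_weight E w $ (j, i)"
      if B: "(j, i) \<in> weighted_reduction E w" for j i
    proof (cases "(j, i) \<in> weighted_reduction H w'")
      case True
      have "(j, i) \<in> H\<^sup>+" using r_into_trancl[OF subsetD[OF assms(2) B]] .
      then show ?thesis
        using kleene_star_weight_reduction[OF H True] kleene_eq by metis
    next
      \<comment> \<open>Impossible: an intermediate node giving equality in \<open>H\<close> would,
        as the Kleene stars agree on \<open>H\<^sup>+\<close>, give equality in \<open>E\<close>,
        against strictness on the reduction.\<close>
      case False
      have ji: "(j, i) \<in> H\<^sup>+" using r_into_trancl[OF subsetD[OF assms(2) B]] .
      obtain k where k: "(j, k) \<in> H\<^sup>+" "(k, i) \<in> H\<^sup>+"
        "kleene_star_weight H w' $ (j, i)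
          = kleene_star_weight H w' $ (j, k) + kleene_star_weight H w' $ (k, i)"
        using nonreduction_triangle_eq[OF H ji False] .
      then show ?thesis
        using reduction_triangle_strict[OF assms(1) B subsetD[OF HT k(1)] subsetD[OF HT k(2)]]
          k(3) kleene_eq[OF ji] kleene_eq[OF k(1)] kleene_eq[OF k(2)] by linarith
    qed
  next
    fix x assume ge: ?ge and eq: ?eq
    show "x \<in> potentials H w'" if x: "x \<in> potentials E w"
      unfolding potentials_def
    proof safe
      fix j i assume ji: "(j, i) \<in> H"
      show "x $ i - x $ j \<le> w' $ (j, i)"
        using potentials_kleene[OF assms(1) x subsetD[OF assms(3) ji]] bspec[OF ge ji] by linarith
    qed
    show "x \<in> potentials H w' \<Longrightarrow> x \<in> potentials E w"
      using potentials_reduction[OF assms(1,2), of w'] eq by blast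
  qed
qed

section \<open>Coordinate cones\<close>

text \<open>The nonnegative orthant of the coordinates in \<open>D\<close>. This is the cone spanned
  by the basis vectors of \<open>D\<close>, in a form where membership is checked one coordinate at
  a time.\<close>

definition coord_cone :: "'e set \<Rightarrow> (real ^ ('e::finite)) set" where
  "coord_cone D = {v. \<forall>e. (e \<in> D \<longrightarrow> 0 \<le> v $ e) \<and> (e \<notin> D \<longrightarrow> v $ e = 0)}"

lemma convex_cone_coord_cone: "convex_cone (coord_cone D)"
  by (auto simp: convex_cone_iff coord_cone_def)

lemma convex_cone_hull_axes: "convex_cone hull {axis e 1 |e. e \<in> D} = coord_cone D"
proof
  show "convex_cone hull {axis e 1 |e. e \<in> D} \<subseteq> coord_cone D"
    by (rule hull_minimal) (auto simp: convex_cone_coord_cone, auto simp: coord_cone_def axis_def)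
  show "coord_cone D \<subseteq> convex_cone hull {axis e 1 |e. e \<in> D}"
  proof
    fix v :: "real ^ 'a" assume v: "v \<in> coord_cone D"
    let ?K = "convex_cone hull {axis e (1::real) |e. e \<in> D}"
    have "(\<Sum>e\<in>A. v $ e *\<^sub>R axis e 1) \<in> ?K" if "finite A" "A \<subseteq> D" for A
      using that
    proof (induction A)
      case empty
      then show ?case by (simp add: convex_cone_hull_contains_0)
    next
      case (insert e A)
      have "axis e 1 \<in> ?K" using insert.prems by (intro hull_inc) auto
      then have "v $ e *\<^sub>R axis e 1 \<in> ?K"
        using v insert.prems by (intro convex_cone_hull_mul) (auto simp: coord_cone_def)
      then show ?case using insert by (simp add: convex_cone_hull_add)
    qed
    then have "(\<Sum>e\<in>D. v $ e *\<^sub>R axis e 1) \<in> ?K" by simp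
    moreover have "(\<Sum>e\<in>D. v $ e *\<^sub>R axis e 1) = v"
      using v by (auto simp: vec_eq_iff coord_cone_def axis_def if_distrib sum.delta cong: if_cong)
    ultimately show "v \<in> ?K" by simp
  qed
qed

lemma pointed_polyhedral_cone_at_coord_cone:
  "pointed_polyhedral_cone_at a ((\<lambda>v. a + v) ` coord_cone D)"
proof -
  have "polyhedron (coord_cone D)"
    unfolding convex_cone_hull_axes[symmetric] by (rule polyhedron_convex_cone_hull) simp
  moreover have "v = 0" if "v \<in> coord_cone D" "- v \<in> coord_cone D" for v
    using that unfolding coord_cone_def vec_eq_iff
    by simp (metis antisym neg_0_le_iff_le)
  ultimately show ?thesis
    unfolding pointed_polyhedral_cone_at_def using convex_cone_coord_cone by blast
qed

lemma recession_cone_translate: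
  assumes "convex_cone K"
  shows "recession_cone ((\<lambda>v. a + v) ` K) = K"
proof
  show "recession_cone ((\<lambda>v. a + v) ` K) \<subseteq> K"
  proof
    fix v assume v: "v \<in> recession_cone ((\<lambda>v. a + v) ` K)"
    \<comment> \<open>Moving one unit from the apex already forces a recession direction into
      \<open>K\<close>.\<close>
    have "a + 0 \<in> (\<lambda>v. a + v) ` K"
      using convex_cone_contains_0[OF assms] by (rule imageI)
    with v have "(a + 0) + 1 *\<^sub>R v \<in> (\<lambda>v. a + v) ` K"
      unfolding recession_cone_def using zero_le_one by blast
    then show "v \<in> K" by auto
  qed
  show "K \<subseteq> recession_cone ((\<lambda>v. a + v) ` K)"
    unfolding recession_cone_def
  proof safe
    fix v u and t :: real assume "v \<in> K" "u \<in> K" "0 \<le> t"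
    then have "u + t *\<^sub>R v \<in> K"
      by (intro convex_cone_add[OF assms] convex_cone_scaleR[OF assms])
    then show "a + u + t *\<^sub>R v \<in> (\<lambda>v. a + v) ` K"
      by (simp add: add.assoc)
  qed
qed

text \<open>At a coordinate outside \<open>D'\<close>, a combination with positive coefficients of
  two nonnegative numbers vanishes, so both numbers vanish.\<close>

lemma coord_cone_face_of:
  assumes "D' \<subseteq> D"
  shows "coord_cone D' face_of coord_cone D"
  unfolding face_of_def
proof (intro conjI ballI impI)
  show "coord_cone D' \<subseteq> coord_cone D"
    using assms unfolding coord_cone_def by safe (metis order_refl subsetD)+
  show "convex (coord_cone D')"
    using convex_cone_coord_cone by (auto simp: convex_cone_def)
  fix a b x
  assume a: "a \<in> coord_cone D" and b: "b \<in> coord_cone D" and x: "x \<in> coord_cone D'"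
    and "x \<in> open_segment a b"
  then obtain u where u: "0 < u" "u < 1" and xu: "x = (1 - u) *\<^sub>R a + u *\<^sub>R b"
    by (auto simp: in_segment)
  have nonneg: "0 \<le> a $ e" "0 \<le> b $ e" for e
    using a b unfolding coord_cone_def by (metis (mono_tags, lifting) mem_Collect_eq order_refl)+
  have "a $ e = 0 \<and> b $ e = 0" if "e \<notin> D'" for e
  proof -
    have "(1 - u) * a $ e + u * b $ e = 0"
      using x that unfolding coord_cone_def xu by simp
    then show ?thesis
      using u nonneg[of e] by (simp add: add_nonneg_eq_0_iff)
  qed
  with nonneg show "a \<in> coord_cone D'" "b \<in> coord_cone D'"
    by (auto simp: coord_cone_def)
qed

lemma coords_coord_cone: "coords (coord_cone D) = D"
proof -
  have "axis e 1 \<in> coord_cone D" if "e \<in> D" for e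
    using that by (auto simp: coord_cone_def axis_def)
  then show ?thesis
    by (force simp: coords_def coord_cone_def)
qed

section \<open>The cone of weights and its compactification\<close>

lemma weight_cone_eq_coord_cone:
  "weight_cone E w =
    (\<lambda>v. kleene_star_weight E w + v) ` coord_cone (E\<^sup>+ - weighted_reduction E w)"
  by (simp only: weight_cone_def convex_cone_hull_axes)

text \<open>Brings the cone into the shape of the criterion \<open>Q_eq_iff_weights\<close> for
  \<open>H = E\<^sup>+\<close>. The default value 0 of the Kleene star weights off
  \<open>E\<^sup>+\<close> matches the convention of \<open>weight_space\<close>.\<close>

lemma mem_weight_cone_iff:
  "w' \<in> weight_cone E w \<longleftrightarrow> w' \<in> weight_space (E\<^sup>+) \<and>
    (\<forall>e\<in>E\<^sup>+. kleene_star_weight E w $ e \<le> w' $ e) \<and>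
    (\<forall>e\<in>weighted_reduction E w. w' $ e = kleene_star_weight E w $ e)"
proof -
  have out: "kleene_star_weight E w $ e = 0" if "e \<notin> E\<^sup>+" for e
    using that by (simp add: kleene_star_weight_def)
  have B: "e \<in> weighted_reduction E w \<Longrightarrow> e \<in> E\<^sup>+" for e
    using weighted_reduction_subset[of E w] by (cases e) auto
  have "w' \<in> weight_cone E w \<longleftrightarrow>
      w' - kleene_star_weight E w \<in> coord_cone (E\<^sup>+ - weighted_reduction E w)"
    unfolding weight_cone_eq_coord_cone by (auto simp: image_iff intro: bexI[of _ "w' - _"])
  also have "\<dots> \<longleftrightarrow> w' \<in> weight_space (E\<^sup>+) \<and>
    (\<forall>e\<in>E\<^sup>+. kleene_star_weight E w $ e \<le> w' $ e) \<and>
    (\<forall>e\<in>weighted_reduction E w. w' $ e = kleene_star_weight E w $ e)"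
    using out B unfolding coord_cone_def weight_space_def
    by (simp del: split_paired_All) (metis order_refl)
  finally show ?thesis .
qed

lemma recession_cone_weight_cone:
  "recession_cone (weight_cone E w) = coord_cone (E\<^sup>+ - weighted_reduction E w)"
  unfolding weight_cone_eq_coord_cone by (rule recession_cone_translate[OF convex_cone_coord_cone])

text \<open>\<open>trop_point\<close> forgets the coordinates outside \<open>H\<close>, and the
  criterion for \<open>H\<close> is the restriction to \<open>H\<close> of the one for
  \<open>E\<^sup>+\<close>. Hence weights on \<open>H\<close> are exactly the truncations of points
  of the cone.\<close>

lemma trop_points_eq_image_weight_cone:
  assumes "acyclic E" and "weighted_reduction E w \<subseteq> H" and "H \<subseteq> E\<^sup>+"
  shows "{trop_point (E\<^sup>+) H w' |w'.
      w' \<in> weight_space H \<and> Q (adj_matrix E w) = Q (adj_matrix H w')}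
    = trop_point (E\<^sup>+) H ` weight_cone E w" (is "?L = ?R")
proof
  note Q_iff = Q_eq_iff_weights[OF assms]
  show "?L \<subseteq> ?R"
  proof safe
    fix w' assume w': "w' \<in> weight_space H" and "Q (adj_matrix E w) = Q (adj_matrix H w')"
    then have *: "\<forall>e\<in>H. kleene_star_weight E w $ e \<le> w' $ e"
      "\<forall>e\<in>weighted_reduction E w. w' $ e = kleene_star_weight E w $ e"
      by (auto simp: Q_iff)
    \<comment> \<open>The Kleene star weight is an admissible value for each missing edge of
      \<open>E\<^sup>+\<close>, and it is 0 elsewhere.\<close>
    let ?v = "\<chi> e. if e \<in> H then w' $ e else kleene_star_weight E w $ e"
    have "?v \<in> weight_cone E w"
      using * assms(2,3) unfolding mem_weight_cone_iff
      by (auto simp: weight_space_def kleene_star_weight_def)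
    moreover have "trop_point (E\<^sup>+) H w' = trop_point (E\<^sup>+) H ?v"
      by (auto simp: trop_point_def restrict_def)
    ultimately show "trop_point (E\<^sup>+) H w' \<in> ?R" by blast
  qed
  show "?R \<subseteq> ?L"
  proof safe
    fix v assume v: "v \<in> weight_cone E w"
    let ?w' = "\<chi> e. if e \<in> H then v $ e else 0"
    have "?w' \<in> weight_space H"
      by (simp add: weight_space_def)
    moreover have "Q (adj_matrix E w) = Q (adj_matrix H ?w')"
      using v assms(2,3) unfolding mem_weight_cone_iff Q_iff by auto
    moreover have "trop_point (E\<^sup>+) H v = trop_point (E\<^sup>+) H ?w'"
      by (auto simp: trop_point_def restrict_def)
    ultimately show "\<exists>w'. trop_point (E\<^sup>+) H v = trop_point (E\<^sup>+) H w' \<and>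
        w' \<in> weight_space H \<and> Q (adj_matrix E w) = Q (adj_matrix H w')"
      by blast
  qed
qed

section \<open>Closure and strata of the embedded cone\<close>

lemma closure_of_trop_ray:
  "top_of_set {- \<infinity><..} closure_of (ereal ` {c..}) = {ereal c..}"
proof -
  \<comment> \<open>As a half-open interval of extended reals, the ray gains only the point
    \<open>\<infinity>\<close> in its closure.\<close>
  have "ereal ` {c..} = {ereal c..<\<infinity>}"
  proof safe
    fix x assume "x \<in> {ereal c..<\<infinity>}"
    then show "x \<in> ereal ` {c..}" by (cases x) auto
  qed auto
  moreover have "{- \<infinity><..} \<inter> {ereal c..<\<infinity>} = {ereal c..<\<infinity>}"
    by (auto intro: less_le_trans[of _ "ereal c"])
  moreover have "{- \<infinity><..} \<inter> {ereal c..\<infinity>} = {ereal c..}"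
    by (auto intro: less_le_trans[of _ "ereal c"])
  ultimately show ?thesis
    by (simp add: closure_of_subtopology)
qed

text \<open>The embedded cone is a product of points and rays, and in the product topology the
  closure is taken factor by factor.\<close>

lemma compactification_weight_cone:
  "compactification (E\<^sup>+) (weight_cone E w) = (\<Pi>\<^sub>E e\<in>E\<^sup>+. if e \<in> weighted_reduction E w
    then {ereal (kleene_star_weight E w $ e)} else {ereal (kleene_star_weight E w $ e)..})"
proof -
  let ?d = "\<lambda>e. kleene_star_weight E w $ e"
  let ?B = "weighted_reduction E w"
  have "trop_point (E\<^sup>+) (E\<^sup>+) ` weight_cone E w =
      (\<Pi>\<^sub>E e\<in>E\<^sup>+. if e \<in> ?B then {ereal (?d e)} else ereal ` {?d e..})" (is "?L = ?R")
  proof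
    show "?L \<subseteq> ?R"
      by (fastforce simp: mem_weight_cone_iff trop_point_def PiE_iff)
    show "?R \<subseteq> ?L"
    proof
      fix f assume f: "f \<in> ?R"
      let ?v = "\<chi> e. if e \<in> E\<^sup>+ then real_of_ereal (f e) else 0"
      have fe: "\<exists>r. f e = ereal r \<and> ?d e \<le> r \<and> (e \<in> ?B \<longrightarrow> r = ?d e)" if "e \<in> E\<^sup>+" for e
        using PiE_mem[OF f that] by (auto split: if_splits)
      have B: "e \<in> ?B \<Longrightarrow> e \<in> E\<^sup>+" for e
        using weighted_reduction_subset[of E w] by (cases e) auto
      have "?v \<in> weight_cone E w"
        using fe B unfolding mem_weight_cone_iff weight_space_def by fastforce
      moreover have "f = trop_point (E\<^sup>+) (E\<^sup>+) ?v"
      proof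
        fix e show "f e = trop_point (E\<^sup>+) (E\<^sup>+) ?v e"
          using fe[of e] PiE_arb[OF f, of e] by (auto simp: trop_point_def)
      qed
      ultimately show "f \<in> ?L" by blast
    qed
  qed
  moreover have "top_of_set {- \<infinity><..} closure_of (if e \<in> ?B then {ereal (?d e)} else ereal ` {?d e..})
      = (if e \<in> ?B then {ereal (?d e)} else {ereal (?d e)..})" for e
    by (cases "e \<in> ?B") (simp_all add: closure_of_trop_ray, simp add: closure_of_subtopology)
  ultimately show ?thesis
    by (simp only: compactification_def trop_space_def closure_of_product_topology)
qed

lemma compactification_eq_strata:
  "compactification (E\<^sup>+) (weight_cone E w) =
    (\<Union>H \<in> {H. weighted_reduction E w \<subseteq> H \<and> H \<subseteq> E\<^sup>+}. trop_point (E\<^sup>+) H ` weight_cone E w)"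
  (is "?L = ?R")
proof
  let ?d = "\<lambda>e. kleene_star_weight E w $ e"
  let ?B = "weighted_reduction E w"
  have B: "?B \<subseteq> E\<^sup>+"
    using weighted_reduction_subset[of E w] by auto
  show "?L \<subseteq> ?R"
  proof
    fix f assume "f \<in> ?L"
    then have f: "f \<in> (\<Pi>\<^sub>E e\<in>E\<^sup>+. if e \<in> ?B then {ereal (?d e)} else {ereal (?d e)..})"
      by (simp only: compactification_weight_cone)
    \<comment> \<open>The finite coordinates of \<open>f\<close> determine its stratum. They include
      the reduction, where \<open>f\<close> is pinned to a real value.\<close>
    define H where "H = {e \<in> E\<^sup>+. f e \<noteq> \<infinity>}"
    let ?v = "\<chi> e. if e \<in> H then real_of_ereal (f e) else ?d e"
    have fe: "ereal (?d e) \<le> f e" "e \<in> ?B \<Longrightarrow> f e = ereal (?d e)" if "e \<in> E\<^sup>+" for e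
      using PiE_mem[OF f that] by (auto split: if_splits)
    have fin: "f e = ereal (real_of_ereal (f e)) \<and> ?d e \<le> real_of_ereal (f e)"
      if "e \<in> H" for e
      using that fe(1)[of e] by (cases "f e") (auto simp: H_def)
    have BH: "?B \<subseteq> H" using B fe(2) by (auto simp: H_def)
    have "?v \<in> weight_cone E w"
      using fin fe(2) B BH unfolding mem_weight_cone_iff weight_space_def
      by (auto simp: H_def kleene_star_weight_def)
    moreover have "f = trop_point (E\<^sup>+) H ?v"
    proof
      fix e show "f e = trop_point (E\<^sup>+) H ?v e"
        using fin[of e] PiE_arb[OF f, of e] by (auto simp: trop_point_def H_def)
    qed
    ultimately show "f \<in> ?R" using BH by (auto simp: H_def)
  qed
  show "?R \<subseteq> ?L"
    unfolding compactification_weight_cone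
    by (fastforce simp: mem_weight_cone_iff trop_point_def PiE_iff)
qed

text \<open>A graph \<open>H\<close> corresponds to the coordinate face on
  \<open>E\<^sup>+ - H\<close>. Conversely, a face \<open>\<tau>\<close> enters only through
  \<open>coords \<tau>\<close>, which avoids the reduction, so
  \<open>E\<^sup>+ - coords \<tau>\<close> is an admissible \<open>H\<close>.\<close>

lemma strata_eq_images_at_infinity:
  "(\<Union>H \<in> {H. weighted_reduction E w \<subseteq> H \<and> H \<subseteq> E\<^sup>+}. trop_point (E\<^sup>+) H ` weight_cone E w) =
    (\<Union>\<tau> \<in> {\<tau>. \<tau> face_of recession_cone (weight_cone E w) \<and> \<tau> \<noteq> {}}.
      image_at_infinity (E\<^sup>+) \<tau> (weight_cone E w))" (is "?L = ?R")
proof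
  let ?D = "E\<^sup>+ - weighted_reduction E w"
  have B: "weighted_reduction E w \<subseteq> E\<^sup>+"
    using weighted_reduction_subset[of E w] by auto
  show "?L \<subseteq> ?R"
  proof (rule UN_least)
    fix H assume "H \<in> {H. weighted_reduction E w \<subseteq> H \<and> H \<subseteq> E\<^sup>+}"
    then have H: "weighted_reduction E w \<subseteq> H" "H \<subseteq> E\<^sup>+" by auto
    let ?\<tau> = "coord_cone (E\<^sup>+ - H)"
    have "?\<tau> face_of recession_cone (weight_cone E w)"
      unfolding recession_cone_weight_cone using H by (intro coord_cone_face_of) auto
    moreover have "?\<tau> \<noteq> {}"
      using convex_cone_nonempty[OF convex_cone_coord_cone] .
    moreover have "image_at_infinity (E\<^sup>+) ?\<tau> (weight_cone E w) = trop_point (E\<^sup>+) H ` weight_cone E w"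
      using H by (simp add: image_at_infinity_def coords_coord_cone double_diff)
    ultimately show "trop_point (E\<^sup>+) H ` weight_cone E w \<subseteq> ?R" by blast
  qed
  show "?R \<subseteq> ?L"
  proof (rule UN_least)
    fix \<tau> assume "\<tau> \<in> {\<tau>. \<tau> face_of recession_cone (weight_cone E w) \<and> \<tau> \<noteq> {}}"
    then have "\<tau> \<subseteq> coord_cone ?D"
      by (simp add: recession_cone_weight_cone face_of_imp_subset)
    then have "coords \<tau> \<subseteq> coords (coord_cone ?D)"
      by (auto simp: coords_def)
    then have "weighted_reduction E w \<subseteq> E\<^sup>+ - coords \<tau>"
      using B by (auto simp: coords_coord_cone)
    then show "image_at_infinity (E\<^sup>+) \<tau> (weight_cone E w) \<subseteq> ?L"
      unfolding image_at_infinity_def by blast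
  qed
qed

theorem theorem4p9:
  fixes E :: "('n::finite \<times> 'n) set" and w :: "real ^ ('n \<times> 'n)"
  assumes "acyclic E" and "w \<in> weight_space E"
  shows "({w' \<in> weight_space (E\<^sup>+). Q (adj_matrix E w) = Q (adj_matrix (E\<^sup>+) w')} = weight_cone E w
          \<and> pointed_polyhedral_cone_at (kleene_star_weight E w) (weight_cone E w))
       \<and> (compactification (E\<^sup>+) (weight_cone E w) =
            {trop_point (E\<^sup>+) H w' |H w'.
               acyclic H \<and> weighted_reduction E w \<subseteq> H \<and> H \<subseteq> E\<^sup>+ \<and> w' \<in> weight_space H \<and>
               Q (adj_matrix E w) = Q (adj_matrix H w')}
          \<and> compactification (E\<^sup>+) (weight_cone E w) =
            (\<Union>\<tau> \<in> {\<tau>. \<tau> face_of recession_cone (weight_cone E w) \<and> \<tau> \<noteq> {}}.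
               image_at_infinity (E\<^sup>+) \<tau> (weight_cone E w)))
       \<and> face_of_compactification (E\<^sup>+) (weight_cone E w)
            {trop_point (E\<^sup>+) E w' |w'.
               w' \<in> weight_space E \<and> Q (adj_matrix E w) = Q (adj_matrix E w')}"
proof (intro conjI)
  let ?B = "weighted_reduction E w" and ?P = "weight_cone E w"
  have B: "?B \<subseteq> E\<^sup>+"
    using weighted_reduction_subset[of E w] by auto
  show "{w' \<in> weight_space (E\<^sup>+). Q (adj_matrix E w) = Q (adj_matrix (E\<^sup>+) w')} = ?P"
    using Q_eq_iff_weights[OF assms(1) B order_refl] by (auto simp: mem_weight_cone_iff)
  show "pointed_polyhedral_cone_at (kleene_star_weight E w) ?P"
    unfolding weight_cone_eq_coord_cone by (rule pointed_polyhedral_cone_at_coord_cone)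
  \<comment> \<open>Subgraphs of the DAG \<open>E\<^sup>+\<close> are DAGs, so the set of weights
    splits as a union over all \<open>H\<close> between the reduction and
    \<open>E\<^sup>+\<close>.\<close>
  have "acyclic H" if "H \<subseteq> E\<^sup>+" for H
    using that acyclic_subset[of "E\<^sup>+" H] assms(1) by (simp add: acyclic_def)
  then have "{trop_point (E\<^sup>+) H w' |H w'. acyclic H \<and> ?B \<subseteq> H \<and> H \<subseteq> E\<^sup>+ \<and> w' \<in> weight_space H \<and>
        Q (adj_matrix E w) = Q (adj_matrix H w')} =
      (\<Union>H \<in> {H. ?B \<subseteq> H \<and> H \<subseteq> E\<^sup>+}. {trop_point (E\<^sup>+) H w' |w'. w' \<in> weight_space H \<and>
        Q (adj_matrix E w) = Q (adj_matrix H w')})"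
    by blast
  also have "\<dots> = compactification (E\<^sup>+) ?P"
    unfolding compactification_eq_strata
    using trop_points_eq_image_weight_cone[OF assms(1)] by (intro SUP_cong) auto
  finally show "compactification (E\<^sup>+) ?P =
      {trop_point (E\<^sup>+) H w' |H w'. acyclic H \<and> ?B \<subseteq> H \<and> H \<subseteq> E\<^sup>+ \<and> w' \<in> weight_space H \<and>
        Q (adj_matrix E w) = Q (adj_matrix H w')}" ..
  show "compactification (E\<^sup>+) ?P =
      (\<Union>\<tau> \<in> {\<tau>. \<tau> face_of recession_cone ?P \<and> \<tau> \<noteq> {}}. image_at_infinity (E\<^sup>+) \<tau> ?P)"
    by (simp only: compactification_eq_strata strata_eq_images_at_infinity)
  \<comment> \<open>The weights on \<open>E\<close> form a whole stratum: \<open>F\<close> is the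
    entire cone, and \<open>?\<tau>\<close> sends to infinity exactly the edges that the transitive
    closure adds to \<open>E\<close>.\<close>
  let ?\<tau> = "coord_cone (E\<^sup>+ - E)"
  have EE: "E \<subseteq> E\<^sup>+" by auto
  have face: "?\<tau> face_of recession_cone ?P"
    unfolding recession_cone_weight_cone using weighted_reduction_subset[of E w]
    by (intro coord_cone_face_of) auto
  have "convex ?P"
    unfolding weight_cone_eq_coord_cone using convex_cone_coord_cone
    by (auto simp: convex_cone_def intro: convex_translation)
  moreover have "?P \<noteq> {}"
    unfolding weight_cone_eq_coord_cone using convex_cone_nonempty[OF convex_cone_coord_cone] by simp
  moreover have "image_at_infinity (E\<^sup>+) ?\<tau> ?P = trop_point (E\<^sup>+) E ` ?P"
    using EE by (simp add: image_at_infinity_def coords_coord_cone double_diff)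
  ultimately show "face_of_compactification (E\<^sup>+) ?P
      {trop_point (E\<^sup>+) E w' |w'. w' \<in> weight_space E \<and> Q (adj_matrix E w) = Q (adj_matrix E w')}"
    unfolding face_of_compactification_def
      trop_points_eq_image_weight_cone[OF assms(1) weighted_reduction_subset EE]
    using face face_of_imp_subset[OF face] face_of_refl convex_cone_nonempty[OF convex_cone_coord_cone]
    by metis
qed

end
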